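(* Let $\mu_X \in \mathbb{R}$, $\epsilon \in \mathbb{R}$ with $\epsilon \neq 0$, and $\sigma_X^2 > 0$, $\sigma_Z^2 > 0$ with $\sigma_X^2 \neq \sigma_Z^2$ (all unknown to the decision maker). Let $X \sim \phi_{\mu_X,\sigma_X^2}$ and $Z \sim \phi_{\mu_X+\epsilon,\sigma_Z^2}$, and let $Y$ be drawn from the 50--50 mixture $\frac12 \phi_{\mu_X,\sigma_X^2} + \frac12 \phi_{\mu_X+\epsilon,\sigma_Z^2}$, the draws being independent. Given the realized values $x, z, y$ of $X, Z, Y$, consider the decision rule for predicting which of the two component distributions $y$ was drawn from: $$C^{dist}(y) := \begin{cases} \phi_{\mu_X,\sigma_X^2} & \text{if } |x-y| < |z-y|,\\ \phi_{\mu_X+\epsilon,\sigma_Z^2} & \text{if } |x-y| > |z-y|. \end{cases}$$ Then the probability that this rule is correct is greater than $1/2$, that is, $$\frac12\,\mathbb{P}\big(|X-Y|<|Z-Y| \,\big|\, Y\sim \phi_{\mu_X,\sigma_X^2}\big) + \frac12\,\mathbb{P}\big(|X-Y|>|Z-Y| \,\big|\, Y\sim \phi_{\mu_X+\epsilon,\sigma_Z^2}\big) > \frac12 .$$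
   Context: $\phi_{m,s^2}$ denotes the Gaussian distribution (and its density) on $\mathbb{R}$ with mean $m$ and variance $s^2$. Drawing $Y$ from the 50--50 mixture means: a fair coin, independent of $X$ and $Z$, selects one of the two component distributions, and $Y$ is then drawn from the selected component, independently of $X$ and $Z$. The notation $\mathbb{P}(\,\cdot \mid Y\sim f)$ means the probability conditional on the selected component being $f$, i.e. the probability when $X, Z, Y$ are independent with $Y \sim f$. The rule is correct when the predicted component is the selected one. The parameters being unknown means only that the decision to predict the component that generated $x$ or the one that generated $z$ uses only the values $x, y, z$. *)

theory Defs
  imports "HOL-Probability.Probability"
begin

text \<open>The density of the normal distribution with mean \<open>m\<close> and variance \<open>v\<close>;
  \<open>normal_density\<close> takes the standard deviation instead of the variance.\<close>

definition gaussian :: "real \<Rightarrow> real \<Rightarrow> real \<Rightarrow> real" where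
  "gaussian m v = normal_density m (sqrt v)"

datatype component = FromX | FromZ

fun component_density ::
  "real \<Rightarrow> real \<Rightarrow> real \<Rightarrow> real \<Rightarrow> component \<Rightarrow> real \<Rightarrow> real" where
  "component_density \<mu> \<epsilon> vX vZ FromX = gaussian \<mu> vX"
| "component_density \<mu> \<epsilon> vX vZ FromZ = gaussian (\<mu> + \<epsilon>) vZ"

text \<open>The rule makes no prediction on a tie \<open>\<bar>x - y\<bar> = \<bar>z - y\<bar>\<close>, so a tie never counts as a
  correct prediction.\<close>

definition C_dist :: "real \<Rightarrow> real \<Rightarrow> real \<Rightarrow> component option" where
  "C_dist x z y =
     (if \<bar>x - y\<bar> < \<bar>z - y\<bar> then Some FromX
      else if \<bar>x - y\<bar> > \<bar>z - y\<bar> then Some FromZ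
      else None)"

text \<open>Independence of two random variables whose ranges may have different types, which
  \<open>indep_var\<close> does not allow. On a common range type this is \<open>indep_var\<close>, see
  \<open>indep_rv_iff_indep_var\<close>.\<close>

definition indep_rv ::
  "'a measure \<Rightarrow> 'b measure \<Rightarrow> ('a \<Rightarrow> 'b) \<Rightarrow> 'c measure \<Rightarrow> ('a \<Rightarrow> 'c) \<Rightarrow> bool" where
  "indep_rv M N F N' G \<longleftrightarrow>
     F \<in> M \<rightarrow>\<^sub>M N \<and> G \<in> M \<rightarrow>\<^sub>M N' \<and>
     prob_space.indep_set M {F -` A \<inter> space M | A. A \<in> sets N}
                            {G -` B \<inter> space M | B. B \<in> sets N'}"

lemma (in prob_space) indep_rv_iff_indep_var:
  "indep_rv M N F N' G \<longleftrightarrow> indep_var N F N' G"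
proof -
  have "case_bool {F -` A \<inter> space M | A. A \<in> sets N} {G -` B \<inter> space M | B. B \<in> sets N'} =
      (\<lambda>i. {case_bool F G i -` A \<inter> space M | A. A \<in> sets (case_bool N N' i)})"
    by (auto simp: fun_eq_iff split: bool.split)
  then show ?thesis
    unfolding indep_rv_def indep_var_def indep_vars_def2 indep_set_def UNIV_bool by auto
qed

end

theory Submission
  imports Defs
begin

text \<open>
  Let \<open>A = Z - X\<close>, a Gaussian with mean \<open>\<epsilon>\<close> and variance \<open>vX + vZ\<close>. The rule predicts \<open>X\<close>'s
  component iff \<open>A\<close> and \<open>(X + Z) / 2 - Y\<close> have the same sign. Given \<open>A = a\<close>, the variable
  \<open>(X + Z) / 2 - Y\<close> is again Gaussian, for either selected component, with a mean affine in \<open>a\<close>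
  and a constant variance (lemma \<open>nn_integral_nearer\<close>, by completing the square). Hence the two
  conditional probabilities of a correct decision are explicit values of the standard normal
  distribution function \<open>\<Phi>\<close>. By symmetry let \<open>\<epsilon> \<ge> 0\<close> and \<open>vX < vZ\<close>; then for suitable
  \<open>0 \<le> c \<le> d\<close> and, if \<open>a > 0\<close>, \<open>0 < k < h\<close>, their sum given \<open>A = a\<close> is
  \<open>1 + (\<Phi> (c + h) + \<Phi> (d - k) - 1)\<close>, and given \<open>A = - a\<close> it is
  \<open>1 - (\<Phi> (c - h) + \<Phi> (d + k) - 1)\<close>.

  The second of these may be below 1, but the deficit is more than compensated by the surplus in
  the first: the two deviations from 1 add up to the standard normal mass of \<open>[c - h, c + h]\<close>
  minus that of \<open>[d - k, d + k]\<close>, and the former interval is longer and centred closer to the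
  origin (lemma \<open>below_mid_prob_pair\<close>). Moreover the deviation at \<open>a\<close> is nonnegative, and \<open>A\<close>,
  having mean \<open>\<epsilon> \<ge> 0\<close>, favours \<open>a\<close> over \<open>- a\<close>. So every pair \<open>\<plusminus> a\<close> contributes a positive
  amount (lemma \<open>excess_pair_pos\<close>), and integrating over \<open>a\<close> shows that the two probabilities of a
  correct decision, one for each selected component, sum to more than 1.
\<close>

section \<open>The standard normal distribution function\<close>

abbreviation \<Phi> :: "real \<Rightarrow> real" where "\<Phi> \<equiv> cdf std_normal_distribution"

abbreviation gauss :: "real \<Rightarrow> real \<Rightarrow> real measure" where
  "gauss m v \<equiv> density lborel (\<lambda>x. ennreal (gaussian m v x))"

interpretation std_normal: real_distribution std_normal_distribution
  by (rule real_dist_normal_dist)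

lemma cdf_std_normal_diff:
  assumes "x \<le> y"
  shows "\<Phi> y - \<Phi> x = integral {x..y} std_normal_density"
proof -
  have int: "set_integrable lborel {x..y} std_normal_density"
    unfolding set_integrable_def by (intro integrable_mult_indicator) auto
  have "\<Phi> y - \<Phi> x = measure std_normal_distribution {x<..y}"
  proof (cases "x = y")
    case False
    with assms show ?thesis by (simp add: std_normal.cdf_diff_eq)
  qed simp
  also have "\<dots> = (LINT t|std_normal_distribution. indicator {x<..y} t)"
    by simp
  also have "\<dots> = (LINT t:{x..y}|lborel. std_normal_density t)"
    unfolding set_lebesgue_integral_def
    by (subst integral_density, simp, simp, simp, rule integral_cong_AE)
       (auto intro!: eventually_mono[OF AE_lborel_singleton[of x]] split: split_indicator)
  also have "\<dots> = integral {x..y} std_normal_density"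
    by (rule set_borel_integral_eq_integral(2)[OF int])
  finally show ?thesis .
qed

lemma DERIV_cdf_std_normal:
  "(\<Phi> has_real_derivative std_normal_density x) (at x)"
proof -
  have c: "continuous_on {x-1..x+1} std_normal_density"
    unfolding normal_density_def by (intro continuous_intros) auto
  have "((\<lambda>t. integral {x-1..t} std_normal_density) has_real_derivative std_normal_density x)
      (at x within {x-1..x+1})"
    by (rule integral_has_real_derivative[OF c]) auto
  then have "((\<lambda>t. \<Phi> (x-1) + integral {x-1..t} std_normal_density) has_real_derivative
      std_normal_density x) (at x)"
    by (subst (asm) at_within_interior) (auto intro!: derivative_eq_intros)
  then show ?thesis
    by (rule DERIV_cong_ev[THEN iffD1, rotated -1])
       (auto intro!: eventually_nhds_in_open[of "{x-1<..<x+1}", THEN eventually_mono]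
             simp: cdf_std_normal_diff[symmetric])
qed

lemma cdf_std_normal_strict_mono:
  assumes "x < y"
  shows "\<Phi> x < \<Phi> y"
proof (rule DERIV_pos_imp_increasing[OF assms])
  show "\<exists>d. (\<Phi> has_real_derivative d) (at t) \<and> 0 < d" for t
    by (rule exI[of _ "std_normal_density t"]) (simp add: DERIV_cdf_std_normal normal_density_pos)
qed

lemma cdf_std_normal_minus: "\<Phi> (- x) = 1 - \<Phi> x"
proof -
  have even: "std_normal_density (- t) = std_normal_density t" for t
    by (simp add: normal_density_def)
  have "((\<lambda>t. \<Phi> t + \<Phi> (-t)) has_real_derivative 0) (at t)" for t
  proof -
    have "((\<lambda>t. \<Phi> (- t)) has_real_derivative std_normal_density (- t) * (- 1)) (at t)"
      by (rule DERIV_chain2[OF DERIV_cdf_std_normal]) (auto intro!: derivative_eq_intros)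
    from DERIV_add[OF DERIV_cdf_std_normal[of t] this] show ?thesis by (simp add: even)
  qed
  then have const: "\<Phi> t + \<Phi> (-t) = \<Phi> x + \<Phi> (-x)" for t
    by (intro DERIV_isconst_all[of "\<lambda>t. \<Phi> t + \<Phi> (-t)"]) blast
  have "((\<lambda>t. \<Phi> t + \<Phi> (-t)) \<longlongrightarrow> 1 + 0) at_top"
    by (rule tendsto_add[OF std_normal.cdf_lim_at_top_prob
        filterlim_compose[OF std_normal.cdf_lim_at_bot filterlim_uminus_at_bot_at_top]])
  moreover have "(\<lambda>t. \<Phi> t + \<Phi> (-t)) = (\<lambda>_. \<Phi> x + \<Phi> (-x))"
    by (intro ext const)
  ultimately have "((\<lambda>t::real. \<Phi> x + \<Phi> (-x)) \<longlongrightarrow> 1 + 0) at_top"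
    by metis
  then show ?thesis
    by (simp add: tendsto_const_iff)
qed

lemma std_normal_density_antimono_abs:
  "\<bar>x\<bar> \<le> \<bar>y\<bar> \<Longrightarrow> std_normal_density y \<le> std_normal_density x"
  using abs_le_square_iff[of x y] by (auto simp: std_normal_density_def divide_right_mono)

text \<open>Moving an interval of fixed length away from the origin trades mass at its near end for
  mass at its far end, where the density is lower: this is the sign of the derivative in the
  centre.\<close>

lemma std_normal_interval_mass_antimono:
  assumes "0 \<le> c" "c \<le> d" "0 \<le> h"
  shows "\<Phi> (d + h) - \<Phi> (d - h) \<le> \<Phi> (c + h) - \<Phi> (c - h)"
proof (rule DERIV_nonpos_imp_nonincreasing[OF assms(2)])
  fix t assume t: "c \<le> t" "t \<le> d"
  have "((\<lambda>t. \<Phi> (t + h) - \<Phi> (t - h)) has_real_derivative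
      std_normal_density (t + h) - std_normal_density (t - h)) (at t)"
    by (auto intro!: derivative_eq_intros DERIV_chain2[OF DERIV_cdf_std_normal])
  moreover have "std_normal_density (t + h) - std_normal_density (t - h) \<le> 0"
    using std_normal_density_antimono_abs[of "t - h" "t + h"] t assms by auto
  ultimately show "\<exists>y. ((\<lambda>t. \<Phi> (t + h) - \<Phi> (t - h)) has_real_derivative y) (at t) \<and> y \<le> 0"
    by blast
qed

lemma measurable_cdf_std_normal [measurable]: "\<Phi> \<in> borel_measurable borel"
  by (intro borel_measurable_continuous_onI continuous_at_imp_continuous_on)
     (auto intro: DERIV_isCont DERIV_cdf_std_normal)

section \<open>Gaussian measures and the difference of two independent draws\<close>

lemma gaussian_altdef:
  "v > 0 \<Longrightarrow> gaussian m v x = exp (- (x - m)\<^sup>2 / (2 * v)) / sqrt (2 * pi * v)"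
  by (simp add: gaussian_def normal_density_def)

lemma gaussian_pos: "v > 0 \<Longrightarrow> gaussian m v x > 0"
  by (simp add: gaussian_def normal_density_pos)

lemma gaussian_nonneg [simp]: "gaussian m v x \<ge> 0"
  by (simp add: gaussian_def)

lemma measurable_gaussian [measurable]: "(\<lambda>p. gaussian (f p) v (g p)) \<in> borel_measurable M"
  if [measurable]: "f \<in> borel_measurable M" "g \<in> borel_measurable M"
  unfolding gaussian_def normal_density_def by measurable

lemma prob_space_gauss: "v > 0 \<Longrightarrow> prob_space (gauss m v)"
  unfolding gaussian_def by (intro prob_space_normal_density) simp

lemma gauss_eq_distr:
  assumes "v > 0"
  shows "gauss m v = distr std_normal_distribution lborel (\<lambda>x. m + sqrt v * x)"
proof -
  have "distributed std_normal_distribution lborel (\<lambda>x. x) (\<lambda>x. ennreal (std_normal_density x))"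
    by (simp add: distributed_def distr_id2)
  from std_normal.normal_density_affine[OF this, of "sqrt v" m] assms show ?thesis
    by (simp add: distributed_def gaussian_def)
qed

lemma emeasure_gauss_lessThan:
  assumes "v > 0"
  shows "emeasure (gauss m v) {..<t} = ennreal (\<Phi> ((t - m) / sqrt v))"
proof -
  have "emeasure (gauss m v) {..<t} = emeasure std_normal_distribution {..<(t - m) / sqrt v}"
    unfolding gauss_eq_distr[OF assms]
    by (subst emeasure_distr) (use assms in
      \<open>auto intro!: arg_cong[where f = "emeasure _"] simp: field_simps\<close>)
  also have "\<dots> = emeasure std_normal_distribution {..(t - m) / sqrt v}"
    by (intro emeasure_eq_AE) (auto simp: AE_density intro!: eventually_mono[OF AE_lborel_singleton[of "(t - m) / sqrt v"]])
  finally show ?thesis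
    by (simp add: std_normal.emeasure_eq_measure cdf_def)
qed

lemma emeasure_gauss_greaterThan:
  assumes "v > 0"
  shows "emeasure (gauss m v) {t<..} = ennreal (1 - \<Phi> ((t - m) / sqrt v))"
proof -
  have "emeasure (gauss m v) {t<..} = emeasure std_normal_distribution {(t - m) / sqrt v<..}"
    unfolding gauss_eq_distr[OF assms]
    by (subst emeasure_distr) (use assms in
      \<open>auto intro!: arg_cong[where f = "emeasure _"] simp: field_simps\<close>)
  also have "{(t - m) / sqrt v<..} = space std_normal_distribution - {..(t - m) / sqrt v}"
    by auto
  finally show ?thesis
    unfolding std_normal.emeasure_eq_measure cdf_def
    by (subst (asm) std_normal.prob_compl) simp_all
qed

lemma complete_square:
  fixes v w p q :: real
  assumes "v > 0" "w > 0"
  shows "p\<^sup>2 / (2 * v) + (p + q)\<^sup>2 / (2 * w) = q\<^sup>2 / (2 * (v + w)) +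
      (p + v / (v + w) * q)\<^sup>2 / (2 * (v * w / (v + w)))"
proof -
  have s: "v + w \<noteq> 0" "v \<noteq> 0" "w \<noteq> 0" using assms by auto
  have "(p + v / (v + w) * q)\<^sup>2 / (2 * (v * w / (v + w))) =
      (p * (v + w) + v * q)\<^sup>2 / (2 * v * w * (v + w))"
    using s by (simp add: power2_eq_square divide_simps)
  moreover have "p\<^sup>2 / (2 * v) = p\<^sup>2 * w * (v + w) / (2 * v * w * (v + w))"
    using s by simp
  moreover have "(p + q)\<^sup>2 / (2 * w) = (p + q)\<^sup>2 * v * (v + w) / (2 * v * w * (v + w))"
    using s by simp
  moreover have "q\<^sup>2 / (2 * (v + w)) = q\<^sup>2 * v * w / (2 * v * w * (v + w))"
    using s by simp
  moreover have "p\<^sup>2 * w * (v + w) + (p + q)\<^sup>2 * v * (v + w) = q\<^sup>2 * v * w + (p * (v + w) + v * q)\<^sup>2"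
    by (simp add: power2_eq_square algebra_simps)
  ultimately show ?thesis by (simp only: add_divide_distrib[symmetric])
qed

text \<open>Completing the square factors the joint density of independent \<open>X\<close> and \<open>Z\<close>, in the
  coordinates \<open>A = Z - X\<close> and \<open>X\<close>, into the density of \<open>A\<close> times the conditional density of
  \<open>X\<close> given \<open>A = a\<close>. That conditional law is again Gaussian, with a mean that is affine in
  \<open>a\<close> and a variance that does not depend on \<open>a\<close>.\<close>

lemma gaussian_mult_shear:
  assumes "v > 0" "w > 0"
  shows "gaussian m v x * gaussian m' w (x + a) =
    gaussian (m' - m) (v + w) a * gaussian (m + v / (v + w) * (m' - m - a)) (v * w / (v + w)) x"
proof -
  have e: "x + a - m' = (x - m) + (a - (m' - m))"
    "x - (m + v / (v + w) * (m' - m - a)) = (x - m) + v / (v + w) * (a - (m' - m))"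
    using assms by (simp_all add: divide_simps) (simp_all add: algebra_simps)
  have "(x - m)\<^sup>2 / (2 * v) + (x + a - m')\<^sup>2 / (2 * w) = (a - (m' - m))\<^sup>2 / (2 * (v + w)) +
      (x - (m + v / (v + w) * (m' - m - a)))\<^sup>2 / (2 * (v * w / (v + w)))"
    unfolding e by (rule complete_square[OF assms])
  then have "exp (- (x - m)\<^sup>2 / (2 * v)) * exp (- (x + a - m')\<^sup>2 / (2 * w)) =
      exp (- (a - (m' - m))\<^sup>2 / (2 * (v + w))) *
      exp (- (x - (m + v / (v + w) * (m' - m - a)))\<^sup>2 / (2 * (v * w / (v + w))))"
    unfolding exp_add[symmetric] minus_divide_left[symmetric] minus_add_distrib[symmetric]
    by (simp only:)
  moreover have "sqrt (2 * pi * v) * sqrt (2 * pi * w) =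
      sqrt (2 * pi * (v + w)) * sqrt (2 * pi * (v * w / (v + w)))"
    using assms by (simp add: real_sqrt_mult[symmetric])
  moreover have "v + w > 0" "v * w / (v + w) > 0" using assms by simp_all
  ultimately show ?thesis
    using assms by (simp only: gaussian_altdef times_divide_times_eq)
qed

lemma nn_integral_gauss_shear:
  assumes "v > 0" "w > 0"
    and [measurable]: "case_prod h \<in> borel_measurable (borel \<Otimes>\<^sub>M borel)"
  shows "(\<integral>\<^sup>+x. \<integral>\<^sup>+z. h x z \<partial>gauss m' w \<partial>gauss m v) =
    (\<integral>\<^sup>+a. \<integral>\<^sup>+x. h x (x + a)
      \<partial>gauss (m + v / (v + w) * (m' - m - a)) (v * w / (v + w)) \<partial>gauss (m' - m) (v + w))"
proof -
  define c where "c a = m + v / (v + w) * (m' - m - a)" for a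
  have [measurable]: "c \<in> borel_measurable borel"
    unfolding c_def by measurable
  have "(\<integral>\<^sup>+x. \<integral>\<^sup>+z. h x z \<partial>gauss m' w \<partial>gauss m v) =
      (\<integral>\<^sup>+x. gaussian m v x * (\<integral>\<^sup>+z. gaussian m' w z * h x z \<partial>lborel) \<partial>lborel)"
    by (simp add: nn_integral_density)
  also have "\<dots> = (\<integral>\<^sup>+x. gaussian m v x * (\<integral>\<^sup>+a. gaussian m' w (x + a) * h x (x + a) \<partial>lborel) \<partial>lborel)"
  proof (rule nn_integral_cong)
    fix x
    have "(\<integral>\<^sup>+z. gaussian m' w z * h x z \<partial>lborel) =
        (\<integral>\<^sup>+a. gaussian m' w (x + a) * h x (x + a) \<partial>lborel)"
      using nn_integral_real_affine[of "\<lambda>z. gaussian m' w z * h x z" 1 x] by simp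
    then show "gaussian m v x * (\<integral>\<^sup>+z. gaussian m' w z * h x z \<partial>lborel) =
        gaussian m v x * (\<integral>\<^sup>+a. gaussian m' w (x + a) * h x (x + a) \<partial>lborel)"
      by simp
  qed
  also have "\<dots> = (\<integral>\<^sup>+x. \<integral>\<^sup>+a. gaussian m v x * (gaussian m' w (x + a) * h x (x + a)) \<partial>lborel \<partial>lborel)"
    by (simp add: nn_integral_cmult)
  also have "\<dots> = (\<integral>\<^sup>+a. \<integral>\<^sup>+x. gaussian m v x * (gaussian m' w (x + a) * h x (x + a)) \<partial>lborel \<partial>lborel)"
    by (rule lborel_pair.Fubini') simp
  also have "\<dots> = (\<integral>\<^sup>+a. \<integral>\<^sup>+x. gaussian (m' - m) (v + w) a *
      (gaussian (c a) (v * w / (v + w)) x * h x (x + a)) \<partial>lborel \<partial>lborel)"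
    unfolding mult.assoc[symmetric]
    by (simp add: ennreal_mult[symmetric] gaussian_mult_shear[OF assms(1,2)] c_def)
  also have "\<dots> = (\<integral>\<^sup>+a. gaussian (m' - m) (v + w) a *
      (\<integral>\<^sup>+x. gaussian (c a) (v * w / (v + w)) x * h x (x + a) \<partial>lborel) \<partial>lborel)"
    by (simp add: nn_integral_cmult)
  also have "\<dots> = (\<integral>\<^sup>+a. \<integral>\<^sup>+x. h x (x + a) \<partial>gauss (c a) (v * w / (v + w)) \<partial>gauss (m' - m) (v + w))"
    by (simp add: nn_integral_density)
  finally show ?thesis unfolding c_def .
qed

lemma nn_integral_gauss_reflect:
  assumes [measurable]: "f \<in> borel_measurable borel"
  shows "(\<integral>\<^sup>+a. f (- a) \<partial>gauss (- m) v) = (\<integral>\<^sup>+a. f a \<partial>gauss m v)"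
proof -
  have "gaussian (- m) v (- a) = gaussian m v a" for a
    by (simp add: gaussian_def normal_density_def power2_commute)
  then show ?thesis
    by (simp add: nn_integral_density, subst nn_integral_real_affine[where c = "-1" and t = 0]) simp_all
qed

lemma AE_gauss_neq: "AE a in gauss m v. a \<noteq> (t::real)"
  by (simp add: AE_density) (use AE_lborel_singleton[of t] in \<open>auto elim: eventually_mono\<close>)

section \<open>The probability of being nearer, conditional on the difference\<close>

text \<open>For independent Gaussian \<open>X\<close>, \<open>Y\<close> of the same mean and variance \<open>v\<close>, and \<open>Z\<close> with mean larger by
  \<open>e\<close> and variance \<open>w\<close>, this is the conditional probability of \<open>Y < (X + Z) / 2\<close> given
  \<open>Z - X = a\<close>.\<close>

definition below_mid_prob :: "real \<Rightarrow> real \<Rightarrow> real \<Rightarrow> real \<Rightarrow> real" where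
  "below_mid_prob v w e a =
     \<Phi> (((w - v) * a + 2 * v * e) / (2 * sqrt (v * (v + 2 * w) * (v + w))))"

text \<open>The conditional probability, in the same setting, that \<open>Y\<close> is nearer to \<open>X\<close> than to \<open>Z\<close>: the
  points nearer to \<open>X\<close> lie below the midpoint if \<open>a > 0\<close>, above it if \<open>a < 0\<close>. The value at
  \<open>a = 0\<close> is arbitrary, as \<open>Z = X\<close> is a null event.\<close>

definition near_prob :: "real \<Rightarrow> real \<Rightarrow> real \<Rightarrow> real \<Rightarrow> real" where
  "near_prob v w e a = (if a > 0 then below_mid_prob v w e a else 1 - below_mid_prob v w e a)"

lemma measurable_near_prob [measurable]: "near_prob v w e \<in> borel_measurable borel"
  unfolding near_prob_def below_mid_prob_def by measurable

lemma near_prob_bounds: "0 \<le> near_prob v w e a" "near_prob v w e a \<le> 1"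
  using std_normal.cdf_nonneg std_normal.cdf_bounded_prob
  by (auto simp: near_prob_def below_mid_prob_def)

lemma near_prob_reflect:
  assumes "a \<noteq> 0"
  shows "near_prob v w (- e) (- a) = near_prob v w e a"
proof -
  have "(w - v) * (- a) + 2 * v * (- e) = - ((w - v) * a + 2 * v * e)"
    by (simp add: algebra_simps)
  then have "below_mid_prob v w (- e) (- a) = 1 - below_mid_prob v w e a"
    by (simp only: below_mid_prob_def cdf_std_normal_minus[symmetric] minus_divide_left)
  with assms show ?thesis by (auto simp: near_prob_def)
qed

text \<open>The shear formula is used twice. The first use replaces \<open>(X, Z)\<close> by \<open>(A, X)\<close> with
  \<open>A = Z - X\<close>; the event then only involves \<open>a\<close> and \<open>Y - X\<close>. The second use replaces
  \<open>(X, Y)\<close>, with \<open>X\<close> conditioned on \<open>A = a\<close>, by \<open>(Y - X, X)\<close>, where \<open>X\<close> integrates out and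
  leaves the Gaussian mass of a half-line bounded by \<open>a / 2\<close>.\<close>

lemma nn_integral_nearer:
  assumes "v > 0" "w > 0"
  shows "(\<integral>\<^sup>+x. \<integral>\<^sup>+z. emeasure (gauss m v) {y. \<bar>x - y\<bar> < \<bar>z - y\<bar>} \<partial>gauss (m + e) w \<partial>gauss m v) =
    (\<integral>\<^sup>+a. ennreal (near_prob v w e a) \<partial>gauss e (v + w))"
proof -
  \<comment> \<open>Mean and variance of \<open>X\<close> given \<open>Z - X = a\<close>.\<close>
  define c where "c a = m + v / (v + w) * (e - a)" for a
  define \<rho> where "\<rho> = v * w / (v + w)"
  have \<rho>: "\<rho> > 0" unfolding \<rho>_def using assms by simp
  interpret Y: prob_space "gauss m v" by (rule prob_space_gauss) fact
  let ?h = "\<lambda>x z y. indicator {y. \<bar>x - y\<bar> < \<bar>z - y\<bar>} y :: ennreal"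
  have "(\<lambda>(x, z). \<integral>\<^sup>+y. ?h x z y \<partial>gauss m v) \<in> borel_measurable (borel \<Otimes>\<^sub>M borel)"
    by measurable
  then have "(\<lambda>(x, z). emeasure (gauss m v) {y. \<bar>x - y\<bar> < \<bar>z - y\<bar>}) \<in> borel_measurable (borel \<Otimes>\<^sub>M borel)"
    by simp
  note nn_integral_gauss_shear[OF assms this, of m "m + e"]
  then have "(\<integral>\<^sup>+x. \<integral>\<^sup>+z. emeasure (gauss m v) {y. \<bar>x - y\<bar> < \<bar>z - y\<bar>} \<partial>gauss (m + e) w \<partial>gauss m v) =
    (\<integral>\<^sup>+a. \<integral>\<^sup>+x. emeasure (gauss m v) {y. \<bar>x - y\<bar> < \<bar>x + a - y\<bar>} \<partial>gauss (c a) \<rho> \<partial>gauss e (v + w))"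
    by (simp add: c_def \<rho>_def)
  also have "\<dots> = (\<integral>\<^sup>+a. ennreal (near_prob v w e a) \<partial>gauss e (v + w))"
  proof (rule nn_integral_cong_AE, rule eventually_mono[OF AE_gauss_neq[where t = 0]])
    fix a :: real assume a: "a \<noteq> 0"
    have "(\<integral>\<^sup>+x. emeasure (gauss m v) {y. \<bar>x - y\<bar> < \<bar>x + a - y\<bar>} \<partial>gauss (c a) \<rho>) =
        (\<integral>\<^sup>+x. \<integral>\<^sup>+y. indicator {b. \<bar>b\<bar> < \<bar>a - b\<bar>} (y - x) \<partial>gauss m v \<partial>gauss (c a) \<rho>)"
    proof (rule nn_integral_cong)
      fix x
      have "emeasure (gauss m v) {y. \<bar>x - y\<bar> < \<bar>x + a - y\<bar>} =
          (\<integral>\<^sup>+y. indicator {y. \<bar>x - y\<bar> < \<bar>x + a - y\<bar>} y \<partial>gauss m v)"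
        by simp
      also have "\<dots> = (\<integral>\<^sup>+y. indicator {b. \<bar>b\<bar> < \<bar>a - b\<bar>} (y - x) \<partial>gauss m v)"
        by (intro nn_integral_cong) (auto split: split_indicator simp: abs_minus_commute algebra_simps)
      finally show "emeasure (gauss m v) {y. \<bar>x - y\<bar> < \<bar>x + a - y\<bar>} =
          (\<integral>\<^sup>+y. indicator {b. \<bar>b\<bar> < \<bar>a - b\<bar>} (y - x) \<partial>gauss m v)" .
    qed
    also have "\<dots> = (\<integral>\<^sup>+b. \<integral>\<^sup>+x. indicator {b. \<bar>b\<bar> < \<bar>a - b\<bar>} b
        \<partial>gauss (c a + \<rho> / (\<rho> + v) * (m - c a - b)) (\<rho> * v / (\<rho> + v)) \<partial>gauss (m - c a) (\<rho> + v))"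
    proof -
      have "{b. \<bar>b\<bar> < \<bar>a - b\<bar>} \<in> sets borel" by measurable
      then have "(\<lambda>(x, y). indicator {b. \<bar>b\<bar> < \<bar>a - b\<bar>} (y - x) :: ennreal)
          \<in> borel_measurable (borel \<Otimes>\<^sub>M borel)" by measurable
      from nn_integral_gauss_shear[OF \<rho> assms(1) this, of "c a" m] show ?thesis by simp
    qed
    also have "\<dots> = (\<integral>\<^sup>+b. indicator {b. \<bar>b\<bar> < \<bar>a - b\<bar>} b \<partial>gauss (m - c a) (\<rho> + v))"
      using prob_space.emeasure_space_1[OF prob_space_gauss] \<rho> assms by simp
    also have "\<dots> = emeasure (gauss (m - c a) (\<rho> + v)) {b. \<bar>b\<bar> < \<bar>a - b\<bar>}"
      by simp
    also have "\<dots> = ennreal (near_prob v w e a)"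
    proof -
      have eq: "(a / 2 - (m - c a)) / sqrt (\<rho> + v) =
          ((w - v) * a + 2 * v * e) / (2 * sqrt (v * (v + 2 * w) * (v + w)))"
      proof -
        have "\<rho> + v = v * (v + 2 * w) / (v + w)"
          using assms by (simp add: \<rho>_def field_simps)
        also have "\<dots> = v * (v + 2 * w) * (v + w) / (v + w)\<^sup>2"
          using assms by (simp add: power2_eq_square)
        finally have "sqrt (\<rho> + v) = sqrt (v * (v + 2 * w) * (v + w)) / (v + w)"
          using assms by (simp add: real_sqrt_divide)
        moreover have "a / 2 - (m - c a) = ((w - v) * a + 2 * v * e) / (2 * (v + w))"
          using assms by (simp add: c_def field_simps)
        ultimately show ?thesis using assms by (simp del: distrib_left_numeral)
      qed
      have pos: "\<rho> + v > 0" using \<rho> assms by simp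
      show ?thesis
      proof (cases "a > 0")
        case True
        then have "{b. \<bar>b\<bar> < \<bar>a - b\<bar>} = {..<a / 2}" by (auto simp: abs_if split: if_splits)
        with True show ?thesis
          by (simp add: emeasure_gauss_lessThan[OF pos] eq near_prob_def below_mid_prob_def)
      next
        case False
        with a have "{b. \<bar>b\<bar> < \<bar>a - b\<bar>} = {a / 2<..}" by (auto simp: abs_if split: if_splits)
        with False show ?thesis
          by (simp add: emeasure_gauss_greaterThan[OF pos] eq near_prob_def below_mid_prob_def)
      qed
    qed
    finally show "(\<integral>\<^sup>+x. emeasure (gauss m v) {y. \<bar>x - y\<bar> < \<bar>x + a - y\<bar>} \<partial>gauss (c a) \<rho>) =
      ennreal (near_prob v w e a)" .
  qed
  finally show ?thesis .
qed

section \<open>Pairing opposite differences\<close>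

text \<open>In terms of \<open>\<Phi>\<close> the two summands at \<open>\<plusminus> a\<close> are \<open>\<Phi> (c \<plusminus> h)\<close> and \<open>\<Phi> (d \<mp> k)\<close>, with
  \<open>c\<close>, \<open>d\<close> proportional to \<open>e\<close> and \<open>h\<close>, \<open>k\<close> proportional to \<open>a\<close>. The second claim therefore says
  that \<open>[c - h, c + h]\<close> has larger standard normal mass than \<open>[d - k, d + k]\<close>. It is the longer
  interval because \<open>v (v + 2 w) < w (w + 2 v)\<close>, and it is centred closer to the origin because
  \<open>v (w + 2 v) \<le> w (v + 2 w)\<close>; both follow from \<open>v < w\<close>.\<close>

lemma below_mid_prob_pair:
  fixes v w e a :: real
  assumes "0 < v" "v < w" "0 \<le> e" "0 < a"
  shows "1 \<le> below_mid_prob v w e a + below_mid_prob w v e a"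
    and "below_mid_prob v w e (- a) + below_mid_prob w v e (- a) < below_mid_prob v w e a + below_mid_prob w v e a"
proof -
  define c where "c v w = 2 * v * e / (2 * sqrt (v * (v + 2 * w) * (v + w)))" for v w :: real
  define h where "h v w = (w - v) * a / (2 * sqrt (v * (v + 2 * w) * (v + w)))" for v w :: real
  have w: "w > 0" using assms by simp
  have half: "below_mid_prob v w e a = \<Phi> (c v w + h v w)" "below_mid_prob v w e (- a) = \<Phi> (c v w - h v w)"
    for v w
    unfolding below_mid_prob_def c_def h_def by (simp_all add: add_divide_distrib diff_divide_distrib add.commute)
  have c_eq: "c v w = e * sqrt (v / ((v + 2 * w) * (v + w)))" if "v > 0" "w > 0" for v w
  proof -
    have "sqrt (v / ((v + 2 * w) * (v + w))) = sqrt (v\<^sup>2 / (v * (v + 2 * w) * (v + w)))"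
      using that by (simp add: power2_eq_square)
    also have "\<dots> = v / sqrt (v * (v + 2 * w) * (v + w))"
      using that by (simp add: real_sqrt_divide)
    finally show ?thesis by (simp add: c_def)
  qed
  have "v / ((v + 2 * w) * (v + w)) \<le> w / ((w + 2 * v) * (w + v))"
  proof -
    have "v * (w + 2 * v) \<le> w * (v + 2 * w)"
      using mult_strict_mono[of v w v w] assms by (simp add: algebra_simps)
    then have "v * (w + 2 * v) / ((v + 2 * w) * (w + 2 * v) * (v + w))
        \<le> w * (v + 2 * w) / ((v + 2 * w) * (w + 2 * v) * (v + w))"
      using assms by (intro divide_right_mono) auto
    then show ?thesis
      using assms by (simp add: mult.assoc add.commute)
  qed
  then have c: "0 \<le> c v w" "c v w \<le> c w v"
    using assms w by (simp_all add: c_eq mult_left_mono)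
  define k where "k = (w - v) * a / (2 * sqrt (w * (w + 2 * v) * (w + v)))"
  have k_eq: "h w v = - k"
    unfolding h_def k_def minus_divide_left minus_mult_left by simp
  have "v * (v + 2 * w) \<le> w * (w + 2 * v)"
    using mult_strict_mono[of v w v w] assms by (simp add: algebra_simps)
  then have "v * (v + 2 * w) < w * (w + 2 * v)"
    using mult_strict_mono[of v w v w] assms by (simp add: algebra_simps)
  then have "sqrt (v * (v + 2 * w) * (v + w)) < sqrt (w * (w + 2 * v) * (w + v))"
    using assms by (simp add: add.commute)
  then have k: "0 \<le> k" "k < h v w"
    using assms w by (auto simp: k_def h_def intro!: divide_strict_left_mono mult_pos_pos)
  have "1 - \<Phi> (c v w + h v w) \<le> \<Phi> (c w v - k)"
    unfolding cdf_std_normal_minus[symmetric]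
    using c k by (intro std_normal.cdf_nondecreasing) linarith
  then show "1 \<le> below_mid_prob v w e a + below_mid_prob w v e a"
    by (simp add: half k_eq)
  have "\<Phi> (c w v + k) - \<Phi> (c w v - k) \<le> \<Phi> (c v w + k) - \<Phi> (c v w - k)"
    using c k by (intro std_normal_interval_mass_antimono)
  also have "\<dots> < \<Phi> (c v w + h v w) - \<Phi> (c v w - h v w)"
    using k by (intro diff_strict_mono[OF cdf_std_normal_strict_mono cdf_std_normal_strict_mono]) auto
  finally show "below_mid_prob v w e (- a) + below_mid_prob w v e (- a) < below_mid_prob v w e a + below_mid_prob w v e a"
    by (simp add: half k_eq)
qed

text \<open>The density of \<open>A\<close>, with law \<open>gauss e (v + w)\<close>, at \<open>a\<close> times the amount by which the two
  conditional probabilities of a correct decision exceed 1 together. It may be negative at one of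
  \<open>a\<close> and \<open>- a\<close>; only the sum over the pair has a sign.\<close>

definition excess :: "real \<Rightarrow> real \<Rightarrow> real \<Rightarrow> real \<Rightarrow> real" where
  "excess v w e a = gaussian e (v + w) a * (near_prob v w e a + near_prob w v e a - 1)"

text \<open>The claim is invariant under exchanging \<open>v\<close> and \<open>w\<close> and under changing the sign of \<open>e\<close> or of
  \<open>a\<close>, so let \<open>v < w\<close>, \<open>e \<ge> 0\<close> and \<open>a > 0\<close>. Then the factor at \<open>a\<close> is nonnegative and exceeds the
  loss at \<open>- a\<close>, while the density, which is centred at \<open>e\<close>, weighs \<open>a\<close> at least as much as
  \<open>- a\<close>.\<close>

lemma excess_pair_pos:
  assumes "v > 0" "w > 0" "v \<noteq> w" "a \<noteq> 0"
  shows "excess v w e a + excess v w e (- a) > 0"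
proof -
  have pos: "excess v w e a + excess v w e (- a) > 0"
    if "0 < v" "v < w" "0 \<le> e" "0 < a" for v w e a :: real
  proof -
    define D where "D a = below_mid_prob v w e a + below_mid_prob w v e a - 1" for a
    have D: "0 \<le> D a" "D (- a) < D a"
      using below_mid_prob_pair[OF that] by (simp_all add: D_def)
    have "- ((a - e)\<^sup>2) \<ge> - ((- a - e)\<^sup>2)"
      using that mult_nonneg_nonneg[of a e] by (simp add: power2_eq_square algebra_simps)
    then have n: "gaussian e (v + w) (- a) \<le> gaussian e (v + w) a"
      using that by (simp add: gaussian_altdef divide_right_mono)
    have "0 < gaussian e (v + w) (- a) * (D a - D (- a))"
      using D that by (intro mult_pos_pos gaussian_pos) auto
    also have "\<dots> \<le> gaussian e (v + w) a * D a - gaussian e (v + w) (- a) * D (- a)"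
      using mult_right_mono[OF n D(1)] by (simp add: algebra_simps)
    also have "\<dots> = excess v w e a + excess v w e (- a)"
      using that by (simp add: excess_def near_prob_def D_def algebra_simps)
    finally show ?thesis .
  qed
  have swap: "excess v w e a = excess w v e a" for v w e a
    by (simp add: excess_def add.commute)
  have reflect: "excess v w (- e) (- a) = excess v w e a" if "a \<noteq> 0" for v w e a
    using near_prob_reflect[OF that] 
    by (simp add: excess_def gaussian_def normal_density_def power2_commute)
  have pos': "excess v w e a + excess v w e (- a) > 0" if "0 < v" "v < w" "a \<noteq> 0" for v w e a
    using pos[of v w e a] pos[of v w e "- a"] pos[of v w "- e" a] pos[of v w "- e" "- a"]
      reflect[of a v w e] reflect[of "- a" v w e] that
    by (cases "0 \<le> e"; cases "0 < a") (simp_all add: add.commute)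
  show ?thesis
    using pos'[of v w a e] pos'[of w v a e] swap assms by (cases "v < w") auto
qed

lemma integral_near_prob_sum_gt_1:
  assumes "v > 0" "w > 0" "v \<noteq> w"
  shows "(\<integral>a. near_prob v w e a + near_prob w v e a \<partial>gauss e (v + w)) > 1"
proof -
  interpret A: prob_space "gauss e (v + w)"
    using assms by (intro prob_space_gauss) simp
  have int: "integrable (gauss e (v + w)) (\<lambda>a. near_prob v w e a + near_prob w v e a)"
  proof (rule A.integrable_const_bound[where B = 2])
    show "AE a in gauss e (v + w). norm (near_prob v w e a + near_prob w v e a) \<le> 2"
    proof (rule AE_I2)
      show "norm (near_prob v w e a + near_prob w v e a) \<le> 2" for a
        using near_prob_bounds[of v w e a] near_prob_bounds[of w v e a] by simp
    qed
  qed measurable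
  then have int': "integrable lborel (excess v w e)"
    using Bochner_Integration.integrable_diff[OF int A.integrable_const[of "1::real"]]
    by (subst (asm) integrable_density) (auto simp: excess_def[abs_def])
  have "(\<integral>a. near_prob v w e a + near_prob w v e a \<partial>gauss e (v + w)) - 1 =
     (\<integral>a. near_prob v w e a + near_prob w v e a - 1 \<partial>gauss e (v + w))"
    using int A.prob_space by simp
  also have "\<dots> = (\<integral>a. excess v w e a \<partial>lborel)"
    by (subst integral_density) (auto simp: excess_def[abs_def])
  finally have 1: "(\<integral>a. near_prob v w e a + near_prob w v e a \<partial>gauss e (v + w)) - 1 =
    (\<integral>a. excess v w e a \<partial>lborel)" .
  have int'': "integrable lborel (\<lambda>a. excess v w e (- a))"
    using lborel_integrable_real_affine[OF int', of "-1" 0] by simp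
  have "(\<integral>a. excess v w e a \<partial>lborel) = (\<integral>a. excess v w e (- a) \<partial>lborel)"
    using lborel_integral_real_affine[of "-1" "excess v w e" 0] by simp
  then have "2 * (\<integral>a. excess v w e a \<partial>lborel) = (\<integral>a. excess v w e a + excess v w e (- a) \<partial>lborel)"
    using int' int'' by simp
  also have "\<dots> > 0"
  proof -
    have pos: "AE a in lborel. excess v w e a + excess v w e (- a) > 0"
      using AE_lborel_singleton[of "0::real"] excess_pair_pos[OF assms] by (auto elim: eventually_mono)
    have int_pair: "integrable lborel (\<lambda>a. excess v w e a + excess v w e (- a))"
      using int' int'' by simp
    have "(\<integral>a. excess v w e a + excess v w e (- a) \<partial>lborel) \<noteq> 0"
    proof
      assume "(\<integral>a. excess v w e a + excess v w e (- a) \<partial>lborel) = 0"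
      moreover have "AE a in lborel. 0 \<le> excess v w e a + excess v w e (- a)"
        using pos by eventually_elim simp
      ultimately have "AE a in lborel. excess v w e a + excess v w e (- a) = 0"
        using integral_nonneg_eq_0_iff_AE[OF int_pair] by blast
      with pos have "AE a in (lborel :: real measure). False"
        by eventually_elim simp
      then show False by (simp add: AE_iff_null emeasure_lborel_UNIV null_sets_def)
    qed
    moreover have "(\<integral>a. excess v w e a + excess v w e (- a) \<partial>lborel) \<ge> 0"
      using pos by (intro integral_nonneg_AE) (auto elim: eventually_mono)
    ultimately show ?thesis by simp
  qed
  finally show ?thesis using 1 by simp
qed

section \<open>From the random experiment to Gaussian integrals\<close>

lemma (in prob_space) indep_rv_distr_pair:
  assumes "indep_rv M N F N' G"
  shows "distr M N F \<Otimes>\<^sub>M distr M N' G = distr M (N \<Otimes>\<^sub>M N') (\<lambda>\<omega>. (F \<omega>, G \<omega>))"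
proof (rule pair_measure_eqI)
  have [measurable]: "F \<in> M \<rightarrow>\<^sub>M N" "G \<in> M \<rightarrow>\<^sub>M N'" using assms by (auto simp: indep_rv_def)
  interpret F: prob_space "distr M N F" by (rule prob_space_distr) simp
  interpret G: prob_space "distr M N' G" by (rule prob_space_distr) simp
  show "sigma_finite_measure (distr M N F)" "sigma_finite_measure (distr M N' G)" by unfold_locales
  show "sets (distr M N F \<Otimes>\<^sub>M distr M N' G) = sets (distr M (N \<Otimes>\<^sub>M N') (\<lambda>\<omega>. (F \<omega>, G \<omega>)))"
    by (simp cong: sets_pair_measure_cong)
  fix A B assume "A \<in> sets (distr M N F)" "B \<in> sets (distr M N' G)"
  then have [measurable]: "A \<in> sets N" "B \<in> sets N'" by simp_all
  have "(\<lambda>\<omega>. (F \<omega>, G \<omega>)) -` (A \<times> B) \<inter> space M = (F -` A \<inter> space M) \<inter> (G -` B \<inter> space M)"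
    by auto
  moreover have "prob ((F -` A \<inter> space M) \<inter> (G -` B \<inter> space M)) =
      prob (F -` A \<inter> space M) * prob (G -` B \<inter> space M)"
    using assms by (intro indep_setD) (auto simp: indep_rv_def)
  ultimately show "emeasure (distr M N F) A * emeasure (distr M N' G) B =
      emeasure (distr M (N \<Otimes>\<^sub>M N') (\<lambda>\<omega>. (F \<omega>, G \<omega>))) (A \<times> B)"
    by (simp add: emeasure_distr emeasure_eq_measure ennreal_mult)
qed

text \<open>The factor 2 on the left undoes the probability \<open>1 / 2\<close> of the coin: the section of the event
  at \<open>(x, z)\<close> has probability \<open>1 / 2\<close> times the mass that the law of \<open>Y\<close> given \<open>S = c\<close> gives
  to it.\<close>

lemma (in prob_space) prob_component_event:
  fixes S :: "'a \<Rightarrow> component" and Q :: "real \<Rightarrow> real \<Rightarrow> real \<Rightarrow> bool"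
  assumes X: "distributed M lborel X (\<lambda>x. ennreal (gaussian mX vX x))"
    and Z: "distributed M lborel Z (\<lambda>x. ennreal (gaussian mZ vZ x))"
    and Y: "distributed (uniform_measure M {\<omega> \<in> space M. S \<omega> = c}) lborel Y (\<lambda>x. ennreal (gaussian mY vY x))"
    and S: "\<P>(\<omega> in M. S \<omega> = c) = 1 / 2"
    and XZ: "indep_var borel X borel Z"
    and XZ_SY: "indep_rv M (borel \<Otimes>\<^sub>M borel) (\<lambda>\<omega>. (X \<omega>, Z \<omega>))
                           (count_space UNIV \<Otimes>\<^sub>M borel) (\<lambda>\<omega>. (S \<omega>, Y \<omega>))"
    and pos: "vX > 0" "vZ > 0"
    and Q [measurable]: "Measurable.pred (borel \<Otimes>\<^sub>M borel \<Otimes>\<^sub>M borel) (\<lambda>(x, z, y). Q x z y)"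
  shows "ennreal (2 * \<P>(\<omega> in M. S \<omega> = c \<and> Q (X \<omega>) (Z \<omega>) (Y \<omega>))) =
    (\<integral>\<^sup>+x. \<integral>\<^sup>+z. emeasure (gauss mY vY) {y. Q x z y} \<partial>gauss mZ vZ \<partial>gauss mX vX)"
proof -
  have [measurable]: "X \<in> borel_measurable M" "Z \<in> borel_measurable M"
    using XZ by (auto dest: indep_var_rv1 indep_var_rv2)
  have SY [measurable]: "(\<lambda>\<omega>. (S \<omega>, Y \<omega>)) \<in> M \<rightarrow>\<^sub>M count_space UNIV \<Otimes>\<^sub>M borel"
    using XZ_SY by (simp add: indep_rv_def)
  have [measurable]: "S \<in> M \<rightarrow>\<^sub>M count_space UNIV" "Y \<in> borel_measurable M"
    using measurable_compose[OF SY measurable_fst] measurable_compose[OF SY measurable_snd] by simp_all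
  define C where "C = {\<omega> \<in> space M. S \<omega> = c}"
  have C [measurable]: "C \<in> events" unfolding C_def by measurable
  interpret gX: prob_space "gauss mX vX" by (rule prob_space_gauss) fact
  interpret gZ: prob_space "gauss mZ vZ" by (rule prob_space_gauss) fact
  have dX: "distr M borel X = gauss mX vX" and dZ: "distr M borel Z = gauss mZ vZ"
    using X Z by (simp_all add: distributed_def cong: distr_cong)
  have dXZ: "distr M (borel \<Otimes>\<^sub>M borel) (\<lambda>\<omega>. (X \<omega>, Z \<omega>)) = gauss mX vX \<Otimes>\<^sub>M gauss mZ vZ"
    using XZ by (simp add: indep_var_distribution_eq dX dZ)
  interpret SY: prob_space "distr M (count_space UNIV \<Otimes>\<^sub>M borel) (\<lambda>\<omega>. (S \<omega>, Y \<omega>))"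
    by (rule prob_space_distr) simp
  define E where "E = {((x, z), (s, y)). s = c \<and> Q x z y}"
  have E [measurable]: "E \<in> sets ((borel \<Otimes>\<^sub>M borel) \<Otimes>\<^sub>M (count_space UNIV \<Otimes>\<^sub>M borel))"
  proof -
    have "Measurable.pred ((borel \<Otimes>\<^sub>M borel) \<Otimes>\<^sub>M (count_space UNIV \<Otimes>\<^sub>M borel))
        (\<lambda>p. fst (snd p) = c \<and> (\<lambda>(x, z, y). Q x z y) (fst (fst p), snd (fst p), snd (snd p)))"
      by measurable
    then show ?thesis
      by (simp add: pred_def E_def case_prod_unfold space_pair_measure)
  qed
  have slice: "2 * emeasure (distr M (count_space UNIV \<Otimes>\<^sub>M borel) (\<lambda>\<omega>. (S \<omega>, Y \<omega>))) (Pair (x, z) -` E) =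
      emeasure (gauss mY vY) {y. Q x z y}" for x z
  proof -
    have B [measurable]: "{y. Q x z y} \<in> sets borel"
    proof -
      have "Measurable.pred borel (\<lambda>y. (\<lambda>(x, z, y). Q x z y) (x, z, y))" by measurable
      then show ?thesis by (simp add: pred_def)
    qed
    have "emeasure (gauss mY vY) {y. Q x z y} =
        emeasure (distr (uniform_measure M C) lborel Y) {y. Q x z y}"
      using Y by (simp add: distributed_def C_def)
    also have "\<dots> = emeasure (uniform_measure M C) (Y -` {y. Q x z y} \<inter> space M)"
      by (subst emeasure_distr) auto
    also have "\<dots> = emeasure M (C \<inter> (Y -` {y. Q x z y} \<inter> space M)) / emeasure M C"
      by (rule emeasure_uniform_measure) measurable
    also have "C \<inter> (Y -` {y. Q x z y} \<inter> space M) =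
        (\<lambda>\<omega>. (S \<omega>, Y \<omega>)) -` (Pair (x, z) -` E) \<inter> space M"
      by (auto simp: C_def E_def)
    also have "emeasure M \<dots> =
        emeasure (distr M (count_space UNIV \<Otimes>\<^sub>M borel) (\<lambda>\<omega>. (S \<omega>, Y \<omega>))) (Pair (x, z) -` E)"
      by (subst emeasure_distr) (auto intro: sets_Pair1[OF E])
    also have "emeasure M C = ennreal (1 / 2)"
      unfolding emeasure_eq_measure C_def S ..
    finally show ?thesis
      unfolding SY.emeasure_eq_measure
      by (subst (asm) divide_ennreal) (simp_all add: ennreal_mult mult.commute)
  qed
  have slice_meas [measurable]: "(\<lambda>p. emeasure (distr M (count_space UNIV \<Otimes>\<^sub>M borel)
      (\<lambda>\<omega>. (S \<omega>, Y \<omega>))) (Pair p -` E)) \<in> borel_measurable (borel \<Otimes>\<^sub>M borel)"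
    using SY.measurable_emeasure_Pair[of E "borel \<Otimes>\<^sub>M borel"] by simp
  then have meas [measurable]: "(\<lambda>(x, z). emeasure (gauss mY vY) {y. Q x z y}) \<in> borel_measurable (borel \<Otimes>\<^sub>M borel)"
    by (simp flip: slice add: case_prod_unfold)
  have "ennreal (2 * \<P>(\<omega> in M. S \<omega> = c \<and> Q (X \<omega>) (Z \<omega>) (Y \<omega>))) =
      2 * emeasure M ((\<lambda>\<omega>. ((X \<omega>, Z \<omega>), (S \<omega>, Y \<omega>))) -` E \<inter> space M)"
    by (auto simp: emeasure_eq_measure ennreal_mult E_def vimage_def Int_def conj_ac intro!: arg_cong[where f = prob])
  also have "\<dots> = 2 * emeasure (distr M (borel \<Otimes>\<^sub>M borel) (\<lambda>\<omega>. (X \<omega>, Z \<omega>)) \<Otimes>\<^sub>M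
      distr M (count_space UNIV \<Otimes>\<^sub>M borel) (\<lambda>\<omega>. (S \<omega>, Y \<omega>))) E"
    unfolding indep_rv_distr_pair[OF XZ_SY] by (subst emeasure_distr) auto
  also have "\<dots> = (\<integral>\<^sup>+p. 2 * emeasure (distr M (count_space UNIV \<Otimes>\<^sub>M borel) (\<lambda>\<omega>. (S \<omega>, Y \<omega>)))
      (Pair p -` E) \<partial>(gauss mX vX \<Otimes>\<^sub>M gauss mZ vZ))"
    unfolding dXZ
    by (subst SY.emeasure_pair_measure_alt, simp cong: sets_pair_measure_cong)
       (subst nn_integral_cmult, simp_all cong: measurable_cong_sets sets_pair_measure_cong)
  also have "\<dots> = (\<integral>\<^sup>+(x, z). emeasure (gauss mY vY) {y. Q x z y} \<partial>(gauss mX vX \<Otimes>\<^sub>M gauss mZ vZ))"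
    by (intro nn_integral_cong) (auto simp: slice)
  also have "\<dots> = (\<integral>\<^sup>+x. \<integral>\<^sup>+z. emeasure (gauss mY vY) {y. Q x z y} \<partial>gauss mZ vZ \<partial>gauss mX vX)"
    by (subst gZ.nn_integral_fst[symmetric]) (simp_all cong: measurable_cong_sets)
  finally show ?thesis .
qed

theorem mainTheorem2:
  fixes M :: "'a measure"
    and \<mu> \<epsilon> vX vZ :: real
    and X Z Y :: "'a \<Rightarrow> real"
    and S :: "'a \<Rightarrow> component"
  assumes "prob_space M"
    and "\<epsilon> \<noteq> 0"
    and "vX > 0" and "vZ > 0" and "vX \<noteq> vZ"
    and X: "distributed M lborel X (gaussian \<mu> vX)"
    and Z: "distributed M lborel Z (gaussian (\<mu> + \<epsilon>) vZ)"
    and fair_coin: "\<And>c. \<P>(\<omega> in M. S \<omega> = c) = 1 / 2"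
    and Y_given_S: "\<And>c. distributed (uniform_measure M {\<omega> \<in> space M. S \<omega> = c}) lborel Y
                            (component_density \<mu> \<epsilon> vX vZ c)"
    and indep_X_Z: "prob_space.indep_var M borel X borel Z"
    and indep_XZ_SY: "indep_rv M (borel \<Otimes>\<^sub>M borel) (\<lambda>\<omega>. (X \<omega>, Z \<omega>))
                                 (count_space UNIV \<Otimes>\<^sub>M borel) (\<lambda>\<omega>. (S \<omega>, Y \<omega>))"
  shows "\<P>(\<omega> in M. C_dist (X \<omega>) (Z \<omega>) (Y \<omega>) = Some (S \<omega>)) > 1 / 2 \<and>
         1 / 2 * \<P>(\<omega> in M. \<bar>X \<omega> - Y \<omega>\<bar> < \<bar>Z \<omega> - Y \<omega>\<bar> \<bar> S \<omega> = FromX) +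
         1 / 2 * \<P>(\<omega> in M. \<bar>X \<omega> - Y \<omega>\<bar> > \<bar>Z \<omega> - Y \<omega>\<bar> \<bar> S \<omega> = FromZ) > 1 / 2"
proof -
  interpret prob_space M by fact
  note pos = \<open>vX > 0\<close> \<open>vZ > 0\<close>
  interpret gA: prob_space "gauss \<epsilon> (vX + vZ)" using pos by (intro prob_space_gauss) simp
  interpret gX: prob_space "gauss \<mu> vX" using pos by (intro prob_space_gauss) simp
  interpret gZ: prob_space "gauss (\<mu> + \<epsilon>) vZ" using pos by (intro prob_space_gauss) simp
  interpret XZ: pair_sigma_finite "gauss \<mu> vX" "gauss (\<mu> + \<epsilon>) vZ" ..
  define pX where "pX = \<P>(\<omega> in M. S \<omega> = FromX \<and> \<bar>X \<omega> - Y \<omega>\<bar> < \<bar>Z \<omega> - Y \<omega>\<bar>)"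
  define pZ where "pZ = \<P>(\<omega> in M. S \<omega> = FromZ \<and> \<bar>X \<omega> - Y \<omega>\<bar> > \<bar>Z \<omega> - Y \<omega>\<bar>)"
  have [measurable]: "X \<in> borel_measurable M" "Z \<in> borel_measurable M"
    using indep_X_Z by (auto dest: indep_var_rv1 indep_var_rv2)
  have SY [measurable]: "(\<lambda>\<omega>. (S \<omega>, Y \<omega>)) \<in> M \<rightarrow>\<^sub>M count_space UNIV \<Otimes>\<^sub>M borel"
    using indep_XZ_SY by (simp add: indep_rv_def)
  have [measurable]: "S \<in> M \<rightarrow>\<^sub>M count_space UNIV" "Y \<in> borel_measurable M"
    using measurable_compose[OF SY measurable_fst] measurable_compose[OF SY measurable_snd] by simp_all

  have "ennreal (2 * pX) = (\<integral>\<^sup>+x. \<integral>\<^sup>+z. emeasure (gauss \<mu> vX) {y. \<bar>x - y\<bar> < \<bar>z - y\<bar>}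
      \<partial>gauss (\<mu> + \<epsilon>) vZ \<partial>gauss \<mu> vX)"
    unfolding pX_def using Y_given_S[of FromX]
    by (intro prob_component_event X Z fair_coin indep_X_Z indep_XZ_SY pos) (simp, measurable)
  also have "\<dots> = (\<integral>\<^sup>+a. ennreal (near_prob vX vZ \<epsilon> a) \<partial>gauss \<epsilon> (vX + vZ))"
    by (rule nn_integral_nearer[OF pos])
  finally have pX: "ennreal (2 * pX) = (\<integral>\<^sup>+a. ennreal (near_prob vX vZ \<epsilon> a) \<partial>gauss \<epsilon> (vX + vZ))" .

  have "ennreal (2 * pZ) = (\<integral>\<^sup>+x. \<integral>\<^sup>+z. emeasure (gauss (\<mu> + \<epsilon>) vZ) {y. \<bar>x - y\<bar> > \<bar>z - y\<bar>}
      \<partial>gauss (\<mu> + \<epsilon>) vZ \<partial>gauss \<mu> vX)"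
    unfolding pZ_def using Y_given_S[of FromZ]
    by (intro prob_component_event X Z fair_coin indep_X_Z indep_XZ_SY pos) (simp, measurable)
  \<comment> \<open>The same situation with the roles of the two components exchanged: the mean of \<open>X\<close> is that of
    \<open>Z\<close> plus \<open>- \<epsilon>\<close>. Reflection then brings both probabilities under one law of the
    difference.\<close>
  also have "\<dots> = (\<integral>\<^sup>+z. \<integral>\<^sup>+x. emeasure (gauss (\<mu> + \<epsilon>) vZ) {y. \<bar>z - y\<bar> < \<bar>x - y\<bar>}
      \<partial>gauss \<mu> vX \<partial>gauss (\<mu> + \<epsilon>) vZ)"
  proof (rule XZ.Fubini'[symmetric])
    have "(\<lambda>(x, z). \<integral>\<^sup>+y. indicator {y. \<bar>z - y\<bar> < \<bar>x - y\<bar>} y \<partial>gauss (\<mu> + \<epsilon>) vZ)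
        \<in> borel_measurable (gauss \<mu> vX \<Otimes>\<^sub>M gauss (\<mu> + \<epsilon>) vZ)"
      by measurable
    then show "(\<lambda>(x, z). emeasure (gauss (\<mu> + \<epsilon>) vZ) {y. \<bar>z - y\<bar> < \<bar>x - y\<bar>})
        \<in> borel_measurable (gauss \<mu> vX \<Otimes>\<^sub>M gauss (\<mu> + \<epsilon>) vZ)"
      by simp
  qed
  also have "\<dots> = (\<integral>\<^sup>+a. ennreal (near_prob vZ vX (- \<epsilon>) a) \<partial>gauss (- \<epsilon>) (vX + vZ))"
    using nn_integral_nearer[OF pos(2,1), of "\<mu> + \<epsilon>" "- \<epsilon>"] by (simp add: add.commute)
  also have "\<dots> = (\<integral>\<^sup>+a. ennreal (near_prob vZ vX (- \<epsilon>) (- a)) \<partial>gauss \<epsilon> (vX + vZ))"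
    by (subst nn_integral_gauss_reflect[symmetric]) simp_all
  also have "\<dots> = (\<integral>\<^sup>+a. ennreal (near_prob vZ vX \<epsilon> a) \<partial>gauss \<epsilon> (vX + vZ))"
    by (intro nn_integral_cong_AE eventually_mono[OF AE_gauss_neq[where t = 0]])
       (simp add: near_prob_reflect)
  finally have pZ: "ennreal (2 * pZ) = (\<integral>\<^sup>+a. ennreal (near_prob vZ vX \<epsilon> a) \<partial>gauss \<epsilon> (vX + vZ))" .

  have int: "integrable (gauss \<epsilon> (vX + vZ)) (near_prob v w \<epsilon>)" for v w
    by (rule gA.integrable_const_bound[where B = 1]) (auto simp: near_prob_bounds)
  have eval: "2 * p = (\<integral>a. near_prob v w \<epsilon> a \<partial>gauss \<epsilon> (vX + vZ))"
    if "ennreal (2 * p) = (\<integral>\<^sup>+a. ennreal (near_prob v w \<epsilon> a) \<partial>gauss \<epsilon> (vX + vZ))" "p \<ge> 0" for p v w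
    using that by (simp add: nn_integral_eq_integral[OF int] near_prob_bounds integral_nonneg)
  have "2 * pX + 2 * pZ = (\<integral>a. near_prob vX vZ \<epsilon> a + near_prob vZ vX \<epsilon> a \<partial>gauss \<epsilon> (vX + vZ))"
    using eval[OF pX] eval[OF pZ] by (simp add: int pX_def pZ_def)
  also have "\<dots> > 1"
    using pos \<open>vX \<noteq> vZ\<close> by (rule integral_near_prob_sum_gt_1)
  finally have sum: "pX + pZ > 1 / 2" by simp

  have "{\<omega> \<in> space M. C_dist (X \<omega>) (Z \<omega>) (Y \<omega>) = Some (S \<omega>)} =
      {\<omega> \<in> space M. S \<omega> = FromX \<and> \<bar>X \<omega> - Y \<omega>\<bar> < \<bar>Z \<omega> - Y \<omega>\<bar>} \<union>
      {\<omega> \<in> space M. S \<omega> = FromZ \<and> \<bar>X \<omega> - Y \<omega>\<bar> > \<bar>Z \<omega> - Y \<omega>\<bar>}"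
    unfolding C_dist_def by (auto split: if_splits)
  then have "\<P>(\<omega> in M. C_dist (X \<omega>) (Z \<omega>) (Y \<omega>) = Some (S \<omega>)) = pX + pZ"
    unfolding pX_def pZ_def by (simp only:) (rule finite_measure_Union; auto)
  moreover have "1 / 2 * \<P>(\<omega> in M. \<bar>X \<omega> - Y \<omega>\<bar> < \<bar>Z \<omega> - Y \<omega>\<bar> \<bar> S \<omega> = FromX) = pX"
    by (simp only: cond_prob_def fair_coin pX_def) (simp add: conj_commute)
  moreover have "1 / 2 * \<P>(\<omega> in M. \<bar>X \<omega> - Y \<omega>\<bar> > \<bar>Z \<omega> - Y \<omega>\<bar> \<bar> S \<omega> = FromZ) = pZ"
    by (simp only: cond_prob_def fair_coin pZ_def) (simp add: conj_commute)
  ultimately show ?thesis using sum by simp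
qed

end
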